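(* Let $\delta\colon C\to D$ be a functor between categories, and let $a\in\mathrm{ob}(C)$. If $\delta$ fulfills (FP) at $a$, then $\delta$ fulfills (P) at $a,b$ for each $b\in\mathrm{ob}(C)$ with $\delta(\hom(a,b))$ finite.
   Context: For a category $C$, $\mathrm{ob}(C)$ is the class of objects and $\hom(a,b)$ is the class of morphisms of $C$ from $a$ to $b$; composition is written $g\cdot f$ (for $f\in\hom(a,b)$, $g\in\hom(b,c)$, $g\cdot f\in\hom(a,c)$). $\mathbb N$ includes $0$. For $r\in\mathbb N$, an $r$-coloring of a set $X$ is a function on $X$ with at most $r$ values. For a functor $\delta$ defined on $C$, $\delta(\hom(a,b))=\{\delta(f)\mid f\in\hom(a,b)\}$. Condition (P). Let $\delta$ be a functor defined on a category $C$ and let $a,b\in \mathrm{ob}(C)$. The functor $\delta$ fulfills (P) at $a,b$ if for each $r\in\mathbb N$ there exists $c\in \mathrm{ob}(C)$ such that for each $r$-coloring $\chi$ of $\hom(a,c)$ there exists $g\in\hom(b,c)$ such that for all $f_1,f_2\in\hom(a,b)$: $\delta(f_1)=\delta(f_2)$ implies $\chi(g\cdot f_1)=\chi(g\cdot f_2)$. Condition (FP). For $h\in\delta(\hom(a,b))$ let $\hom(a,b)_h=\{f\in\hom(a,b)\mid\delta(f)=h\}$. The functor $\delta$ fulfills (FP) at $a,b\in\mathrm{ob}(C)$ if for each $r\in\mathbb N$ and each finite non-empty set $s\subseteq\delta(\hom(a,b))$ there exist $c\in\mathrm{ob}(C)$, $f'\in s$, and $g'\in\delta(\hom(b,c))$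 such that for each $r$-coloring $\chi$ of $\hom(a,c)$ there exists $g\in\hom(b,c)$ for which (1) $\chi$ is constant on the set $g\cdot\hom(a,b)_{f'}=\{g\cdot f\mid f\in\hom(a,b)_{f'}\}$, and (2) $\delta(g)\cdot e=g'\cdot e$ for each $e\in s$. The functor $\delta$ fulfills (FP) at $a\in\mathrm{ob}(C)$ if it fulfills (FP) at $a,b$ for all $b\in\mathrm{ob}(C)$. *)

theory Defs
  imports Main
begin

record ('o, 'm) cat =
  Ob  :: "'o set"
  Arr :: "'m set"
  Dom :: "'m \<Rightarrow> 'o"
  Cod :: "'m \<Rightarrow> 'o"
  Ident :: "'o \<Rightarrow> 'm"
  Comp :: "'m \<Rightarrow> 'm \<Rightarrow> 'm"  (infixl \<open>\<cdot>\<index>\<close> 70)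

definition hom :: "('o, 'm) cat \<Rightarrow> 'o \<Rightarrow> 'o \<Rightarrow> 'm set" where
  "hom C a b = {f \<in> Arr C. Dom C f = a \<and> Cod C f = b}"

(* The fields are total functions; Dom, Cod, Ident and Comp are constrained only on
   arrows, objects and composable pairs, and Comp g f is "g after f". *)
locale category =
  fixes C :: "('o, 'm) cat"  (structure)
  assumes Dom_closed: "f \<in> Arr C \<Longrightarrow> Dom C f \<in> Ob C"
    and Cod_closed: "f \<in> Arr C \<Longrightarrow> Cod C f \<in> Ob C"
    and Ident_closed: "a \<in> Ob C \<Longrightarrow> Ident C a \<in> hom C a a"
    and Comp_closed: "f \<in> hom C a b \<Longrightarrow> g \<in> hom C b c \<Longrightarrow> g \<cdot> f \<in> hom C a c"
    and Comp_Ident: "f \<in> hom C a b \<Longrightarrow> f \<cdot> Ident C a = f"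
    and Ident_Comp: "f \<in> hom C a b \<Longrightarrow> Ident C b \<cdot> f = f"
    and Comp_assoc: "f \<in> hom C a b \<Longrightarrow> g \<in> hom C b c \<Longrightarrow> h \<in> hom C c d \<Longrightarrow>
          h \<cdot> (g \<cdot> f) = (h \<cdot> g) \<cdot> f"

record ('o, 'm, 'p, 'n) functor_maps =
  ob_map :: "'o \<Rightarrow> 'p"
  arr_map :: "'m \<Rightarrow> 'n"

locale functor_between = C: category C + D: category D
  for C :: "('o, 'm) cat" and D :: "('p, 'n) cat" +
  fixes \<delta> :: "('o, 'm, 'p, 'n) functor_maps"
  assumes ob_map_closed: "a \<in> Ob C \<Longrightarrow> ob_map \<delta> a \<in> Ob D"
    and arr_map_closed: "f \<in> hom C a b \<Longrightarrow> arr_map \<delta> f \<in> hom D (ob_map \<delta> a) (ob_map \<delta> b)"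
    and arr_map_Ident: "a \<in> Ob C \<Longrightarrow> arr_map \<delta> (Ident C a) = Ident D (ob_map \<delta> a)"
    and arr_map_Comp: "f \<in> hom C a b \<Longrightarrow> g \<in> hom C b c \<Longrightarrow>
          arr_map \<delta> (g \<cdot>\<^bsub>C\<^esub> f) = arr_map \<delta> g \<cdot>\<^bsub>D\<^esub> arr_map \<delta> f"

(* A coloring of X with at most r values. Taking natural numbers as colors loses no
   generality: the finitely many values can be renamed injectively. For r = 0 only the
   empty set has a coloring. *)
definition coloring :: "nat \<Rightarrow> 'm set \<Rightarrow> ('m \<Rightarrow> nat) \<Rightarrow> bool" where
  "coloring r X \<chi> \<longleftrightarrow> finite (\<chi> ` X) \<and> card (\<chi> ` X) \<le> r"

definition P_at :: "('o, 'm) cat \<Rightarrow> ('o, 'm, 'p, 'n) functor_maps \<Rightarrow> 'o \<Rightarrow> 'o \<Rightarrow> bool" where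
  "P_at C \<delta> a b \<longleftrightarrow>
     (\<forall>r. \<exists>c \<in> Ob C. \<forall>\<chi>. coloring r (hom C a c) \<chi> \<longrightarrow>
        (\<exists>g \<in> hom C b c. \<forall>f\<^sub>1 \<in> hom C a b. \<forall>f\<^sub>2 \<in> hom C a b.
           arr_map \<delta> f\<^sub>1 = arr_map \<delta> f\<^sub>2 \<longrightarrow> \<chi> (g \<cdot>\<^bsub>C\<^esub> f\<^sub>1) = \<chi> (g \<cdot>\<^bsub>C\<^esub> f\<^sub>2)))"

definition hom_fiber ::
    "('o, 'm) cat \<Rightarrow> ('o, 'm, 'p, 'n) functor_maps \<Rightarrow> 'o \<Rightarrow> 'o \<Rightarrow> 'n \<Rightarrow> 'm set" where
  "hom_fiber C \<delta> a b h = {f \<in> hom C a b. arr_map \<delta> f = h}"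

definition FP_at_pair ::
    "('o, 'm) cat \<Rightarrow> ('p, 'n) cat \<Rightarrow> ('o, 'm, 'p, 'n) functor_maps \<Rightarrow> 'o \<Rightarrow> 'o \<Rightarrow> bool" where
  "FP_at_pair C D \<delta> a b \<longleftrightarrow>
     (\<forall>r s. finite s \<longrightarrow> s \<noteq> {} \<longrightarrow> s \<subseteq> arr_map \<delta> ` hom C a b \<longrightarrow>
        (\<exists>c \<in> Ob C. \<exists>f' \<in> s. \<exists>g' \<in> arr_map \<delta> ` hom C b c.
           \<forall>\<chi>. coloring r (hom C a c) \<chi> \<longrightarrow>
             (\<exists>g \<in> hom C b c.
                (\<exists>k. \<forall>x \<in> (\<lambda>f. g \<cdot>\<^bsub>C\<^esub> f) ` hom_fiber C \<delta> a b f'. \<chi> x = k) \<and>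
                (\<forall>e \<in> s. arr_map \<delta> g \<cdot>\<^bsub>D\<^esub> e = g' \<cdot>\<^bsub>D\<^esub> e))))"

definition FP_at ::
    "('o, 'm) cat \<Rightarrow> ('p, 'n) cat \<Rightarrow> ('o, 'm, 'p, 'n) functor_maps \<Rightarrow> 'o \<Rightarrow> bool" where
  "FP_at C D \<delta> a \<longleftrightarrow> (\<forall>b \<in> Ob C. FP_at_pair C D \<delta> a b)"

end

theory Submission imports Defs begin

(* The fibers over a finite set s of values are made monochromatic one at a time. (FP) chooses
   f' in s and g' before any coloring is given, so the induction hypothesis may be applied to the
   pushed-forward set g' . (s - {f'}) at the object c; this yields d. A coloring chi of hom(a,d)
   first gives h in hom(c,d) by induction, and then (FP), applied to x |-> chi (h . x), gives g.
   The composite h . g works: the fiber over f' is handled by g, and every other fiber is sent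
   by g into a fiber over g' . (s - {f'}), which is handled by h. *)

lemma coloring_compose:
  assumes "coloring r Y \<chi>" "h ` X \<subseteq> Y"
  shows "coloring r X (\<lambda>x. \<chi> (h x))"
proof -
  have "(\<lambda>x. \<chi> (h x)) ` X \<subseteq> \<chi> ` Y"
    using assms(2) by auto
  then show ?thesis
    using assms(1) unfolding coloring_def
    by (meson card_mono finite_subset le_trans)
qed

context functor_between
begin

text \<open>Restricting (P) to the fibers over a finite \<open>s\<close> makes room for an induction
  on the size of \<open>s\<close>. The object \<open>b\<close> has to vary with \<open>s\<close>,
  since the remaining fibers are treated at the object \<open>c\<close> that (FP) supplies; hence
  (FP) is assumed at \<open>a\<close> with every second object. The number \<open>r\<close> stays
  fixed throughout.\<close>

lemma monochromatic_fibers: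
  assumes FP: "FP_at C D \<delta> a"
    and "b \<in> Ob C" "finite s" "s \<subseteq> arr_map \<delta> ` hom C a b"
  shows "\<exists>c \<in> Ob C. \<forall>\<chi>. coloring r (hom C a c) \<chi> \<longrightarrow>
    (\<exists>g \<in> hom C b c. \<forall>f\<^sub>1 \<in> hom C a b. \<forall>f\<^sub>2 \<in> hom C a b.
       arr_map \<delta> f\<^sub>1 \<in> s \<longrightarrow> arr_map \<delta> f\<^sub>1 = arr_map \<delta> f\<^sub>2 \<longrightarrow>
       \<chi> (g \<cdot>\<^bsub>C\<^esub> f\<^sub>1) = \<chi> (g \<cdot>\<^bsub>C\<^esub> f\<^sub>2))"
  using assms(2-)
\<comment> \<open>The induction is strong because composing with \<open>g'\<close> may identify
  elements of \<open>s - {f'}\<close>, so that \<open>t\<close> below can be smaller than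
  \<open>s\<close> by more than one.\<close>
proof (induction "card s" arbitrary: b s rule: less_induct)
  case less
  show ?case
  proof (cases "s = {}")
    case True
    \<comment> \<open>No fiber is prescribed, so \<open>c = b\<close> with its identity as
      \<open>g\<close> will do.\<close>
    then show ?thesis
      using less.prems(1) C.Ident_closed by blast
  next
    case False
    then obtain c f' g' where c: "c \<in> Ob C" and f': "f' \<in> s"
      and g': "g' \<in> arr_map \<delta> ` hom C b c"
      and FP_c: "\<And>\<chi>. coloring r (hom C a c) \<chi> \<Longrightarrow>
        \<exists>g \<in> hom C b c.
          (\<exists>k. \<forall>x \<in> (\<lambda>f. g \<cdot>\<^bsub>C\<^esub> f) ` hom_fiber C \<delta> a b f'. \<chi> x = k) \<and>
          (\<forall>e \<in> s. arr_map \<delta> g \<cdot>\<^bsub>D\<^esub> e = g' \<cdot>\<^bsub>D\<^esub> e)"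
      using FP less.prems unfolding FP_at_def FP_at_pair_def by metis
    define t where "t = (\<lambda>e. g' \<cdot>\<^bsub>D\<^esub> e) ` (s - {f'})"
    have "card t \<le> card (s - {f'})"
      unfolding t_def using less.prems(2) by (simp add: card_image_le)
    also have "\<dots> < card s"
      using less.prems(2) f' by (rule card_Diff1_less)
    finally have "card t < card s" .
    moreover have "finite t"
      unfolding t_def using less.prems(2) by simp
    \<comment> \<open>By functoriality, arrows \<open>u\<close> over \<open>g'\<close> and
      \<open>f\<close> over \<open>e\<close> compose to an arrow over their product. The arrow
      \<open>g\<close> that (FP) yields for a coloring need not lie over \<open>g'\<close>: the two
      are only known to agree on composites with elements of \<open>s\<close>.\<close>
    moreover have "t \<subseteq> arr_map \<delta> ` hom C a c"
    proof
      fix y assume "y \<in> t"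
      then obtain e where e: "e \<in> s" "y = g' \<cdot>\<^bsub>D\<^esub> e"
        unfolding t_def by auto
      obtain u where u: "u \<in> hom C b c" "g' = arr_map \<delta> u"
        using g' by auto
      obtain f where f: "f \<in> hom C a b" "e = arr_map \<delta> f"
        using e(1) less.prems(3) by auto
      have "y = arr_map \<delta> (u \<cdot>\<^bsub>C\<^esub> f)"
        using e(2) u(2) f(2) arr_map_Comp[OF f(1) u(1)] by simp
      then show "y \<in> arr_map \<delta> ` hom C a c"
        using C.Comp_closed[OF f(1) u(1)] by blast
    qed
    ultimately obtain d where d: "d \<in> Ob C"
      and IH: "\<And>\<chi>. coloring r (hom C a d) \<chi> \<Longrightarrow>
        \<exists>h \<in> hom C c d. \<forall>x\<^sub>1 \<in> hom C a c. \<forall>x\<^sub>2 \<in> hom C a c.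
          arr_map \<delta> x\<^sub>1 \<in> t \<longrightarrow> arr_map \<delta> x\<^sub>1 = arr_map \<delta> x\<^sub>2 \<longrightarrow>
          \<chi> (h \<cdot>\<^bsub>C\<^esub> x\<^sub>1) = \<chi> (h \<cdot>\<^bsub>C\<^esub> x\<^sub>2)"
      using less.hyps[of t c] c by metis
    have "\<exists>g \<in> hom C b d. \<forall>f\<^sub>1 \<in> hom C a b. \<forall>f\<^sub>2 \<in> hom C a b.
        arr_map \<delta> f\<^sub>1 \<in> s \<longrightarrow> arr_map \<delta> f\<^sub>1 = arr_map \<delta> f\<^sub>2 \<longrightarrow>
        \<chi> (g \<cdot>\<^bsub>C\<^esub> f\<^sub>1) = \<chi> (g \<cdot>\<^bsub>C\<^esub> f\<^sub>2)"
      if \<chi>: "coloring r (hom C a d) \<chi>" for \<chi>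
    proof -
      obtain h where h: "h \<in> hom C c d"
        and h_mono: "\<And>x\<^sub>1 x\<^sub>2. \<lbrakk>x\<^sub>1 \<in> hom C a c; x\<^sub>2 \<in> hom C a c;
          arr_map \<delta> x\<^sub>1 \<in> t; arr_map \<delta> x\<^sub>1 = arr_map \<delta> x\<^sub>2\<rbrakk> \<Longrightarrow>
          \<chi> (h \<cdot>\<^bsub>C\<^esub> x\<^sub>1) = \<chi> (h \<cdot>\<^bsub>C\<^esub> x\<^sub>2)"
        using IH[OF \<chi>] by blast
      \<comment> \<open>Pulling \<open>\<chi>\<close> back along \<open>h\<close> does not increase
        the number of values, so (FP) applies with the same \<open>r\<close>.\<close>
      have "(\<lambda>x. h \<cdot>\<^bsub>C\<^esub> x) ` hom C a c \<subseteq> hom C a d"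
        using C.Comp_closed h by blast
      then have "coloring r (hom C a c) (\<lambda>x. \<chi> (h \<cdot>\<^bsub>C\<^esub> x))"
        by (rule coloring_compose[OF \<chi>])
      from FP_c[OF this] obtain g k where g: "g \<in> hom C b c"
        and g_mono: "\<And>f. f \<in> hom_fiber C \<delta> a b f' \<Longrightarrow>
          \<chi> (h \<cdot>\<^bsub>C\<^esub> (g \<cdot>\<^bsub>C\<^esub> f)) = k"
        and g_eq: "\<And>e. e \<in> s \<Longrightarrow> arr_map \<delta> g \<cdot>\<^bsub>D\<^esub> e = g' \<cdot>\<^bsub>D\<^esub> e"
        by auto
      show ?thesis
      proof (intro bexI ballI impI)
        show "h \<cdot>\<^bsub>C\<^esub> g \<in> hom C b d"
          using g h by (rule C.Comp_closed)
      next
        fix f\<^sub>1 f\<^sub>2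
        assume f: "f\<^sub>1 \<in> hom C a b" "f\<^sub>2 \<in> hom C a b"
          and s: "arr_map \<delta> f\<^sub>1 \<in> s" and eq: "arr_map \<delta> f\<^sub>1 = arr_map \<delta> f\<^sub>2"
        have "\<chi> (h \<cdot>\<^bsub>C\<^esub> (g \<cdot>\<^bsub>C\<^esub> f\<^sub>1)) = \<chi> (h \<cdot>\<^bsub>C\<^esub> (g \<cdot>\<^bsub>C\<^esub> f\<^sub>2))"
        proof (cases "arr_map \<delta> f\<^sub>1 = f'")
          case True
          then show ?thesis
            using f eq g_mono by (simp add: hom_fiber_def)
        next
          case False
          \<comment> \<open>Although \<open>g\<close> depends on \<open>\<chi>\<close>, its effect
            on \<open>s\<close> is that of the prescribed \<open>g'\<close>; thus the composites lie
            over the set \<open>t\<close> for which \<open>h\<close> was chosen.\<close>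
          have "arr_map \<delta> (g \<cdot>\<^bsub>C\<^esub> f\<^sub>1) = g' \<cdot>\<^bsub>D\<^esub> arr_map \<delta> f\<^sub>1"
            using arr_map_Comp[OF f(1) g] g_eq[OF s] by simp
          then have "arr_map \<delta> (g \<cdot>\<^bsub>C\<^esub> f\<^sub>1) \<in> t"
            unfolding t_def using s False by blast
          moreover have "arr_map \<delta> (g \<cdot>\<^bsub>C\<^esub> f\<^sub>1) = arr_map \<delta> (g \<cdot>\<^bsub>C\<^esub> f\<^sub>2)"
            using arr_map_Comp[OF f(1) g] arr_map_Comp[OF f(2) g] eq by simp
          ultimately show ?thesis
            using h_mono C.Comp_closed f g by blast
        qed
        then show "\<chi> (h \<cdot>\<^bsub>C\<^esub> g \<cdot>\<^bsub>C\<^esub> f\<^sub>1) = \<chi> (h \<cdot>\<^bsub>C\<^esub> g \<cdot>\<^bsub>C\<^esub> f\<^sub>2)"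
          using C.Comp_assoc[OF f(1) g h] C.Comp_assoc[OF f(2) g h] by simp
      qed
    qed
    then show ?thesis
      using d by blast
  qed
qed

end

theorem theorem20:
  fixes C :: "('o, 'm) cat" and D :: "('p, 'n) cat"
    and \<delta> :: "('o, 'm, 'p, 'n) functor_maps" and a :: 'o
  assumes "functor_between C D \<delta>"
    and "a \<in> Ob C"
    and "FP_at C D \<delta> a"
  shows "\<forall>b \<in> Ob C. finite (arr_map \<delta> ` hom C a b) \<longrightarrow> P_at C \<delta> a b"
proof (intro ballI impI)
  fix b assume b: "b \<in> Ob C" "finite (arr_map \<delta> ` hom C a b)"
  show "P_at C \<delta> a b"
    \<comment> \<open>Taking \<open>s\<close> to be the whole image of \<open>hom C a b\<close>
      makes the premise \<open>arr_map \<delta> f\<^sub>1 \<in> s\<close> automatic.\<close>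
    unfolding P_at_def
    using functor_between.monochromatic_fibers[OF assms(1,3) b order_refl]
    by simp
qed

end
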